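(* Let $A\in\mathbb{R}^{m\times n}$ with $m\ge n$ and $A^\top A$ of full rank, let $b\in\mathbb{R}^m$ and $\lambda>0$. The optimal solution $x^*$ of the Lasso problem $$\min_{x\in\mathbb{R}^n}\ \frac12\|Ax-b\|_2^2+\lambda\|x\|_1$$ can be recovered from the optimal solution $z^*$ of the box-constrained QP $$\min_{z\in\mathbb{R}^n}\ \frac12z^\top Hz+z^\top h\quad\text{s.t.}\quad -e\le z\le e,$$ with data $H=\lambda(A^\top A)^{-1}$ and $h=-(A^\top A)^{-1}A^\top b$, by $$x^*=(A^\top A)^{-1}(A^\top b-\lambda z^* ).$$
   Context: $e$ is the all-ones vector in $\mathbb{R}^n$; inequalities between vectors are componentwise. *)

theory Defs
  imports "HOL-Analysis.Analysis"
begin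

definition l1_norm :: "real ^ 'n \<Rightarrow> real" where
  "l1_norm x = (\<Sum>i\<in>UNIV. \<bar>x $ i\<bar>)"

definition lasso_objective ::
  "real ^ 'n ^ 'm \<Rightarrow> real ^ 'm \<Rightarrow> real \<Rightarrow> real ^ 'n \<Rightarrow> real" where
  "lasso_objective A b lam x = 1 / 2 * (norm (A *v x - b))\<^sup>2 + lam * l1_norm x"

definition is_lasso_solution ::
  "real ^ 'n ^ 'm \<Rightarrow> real ^ 'm \<Rightarrow> real \<Rightarrow> real ^ 'n \<Rightarrow> bool" where
  "is_lasso_solution A b lam x \<longleftrightarrow> is_arg_min (lasso_objective A b lam) (\<lambda>_. True) x"

definition qp_objective :: "real ^ 'n ^ 'n \<Rightarrow> real ^ 'n \<Rightarrow> real ^ 'n \<Rightarrow> real" where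
  "qp_objective H h z = 1 / 2 * (z \<bullet> (H *v z)) + z \<bullet> h"

(* The order on real ^ 'n is the componentwise one; vec 1 is the all-ones vector. *)
definition is_box_qp_solution :: "real ^ 'n ^ 'n \<Rightarrow> real ^ 'n \<Rightarrow> real ^ 'n \<Rightarrow> bool" where
  "is_box_qp_solution H h z \<longleftrightarrow>
     is_arg_min (qp_objective H h) (\<lambda>z. - vec 1 \<le> z \<and> z \<le> vec 1) z"

end

theory Submission
  imports Defs
begin

text \<open>
  Write \<open>G = A\<^sup>T A\<close> and \<open>c = A\<^sup>T b\<close>.  The quadratic program is the dual of the Lasso problem:
  the box is the subdifferential of the \<open>\<ell>\<^sub>1\<close> norm at the origin, so that
  \<open>l1_norm x\<close> is the maximum of \<open>x \<bullet> w\<close> over the box, and the box variable \<open>z\<close> plays the role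
  of a subgradient of the norm at the Lasso solution.

  A minimizer \<open>z\<close> over the box exists by compactness.  The gradient of the quadratic objective
  there is \<open>H z + h = - x\<close>, where \<open>x = G\<^sup>-\<^sup>1 (c - \<lambda> z)\<close> is the point of the recovery formula.
  Hence the first-order optimality condition on the convex box
  (\<open>quadratic_minimizer_variational_inequality\<close>) says that \<open>w = z\<close> maximizes \<open>x \<bullet> w\<close> over the
  box, that is, \<open>x \<bullet> z = l1_norm x\<close>.  Since also \<open>G x - c = - \<lambda> z\<close>, this is the Lasso
  optimality condition, and expanding the square around \<open>x\<close> shows that the Lasso objective
  exceeds its value at \<open>x\<close> by at least \<open>\<parallel>A (y - x)\<parallel>\<^sup>2 / 2\<close> at every \<open>y\<close>
  (\<open>lasso_growth_from_certificate\<close>).  As \<open>A\<close> is injective, \<open>x\<close> is the only Lasso solution.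

  So every box minimizer \<open>z\<close> yields the one Lasso solution through an injective map of \<open>z\<close>.
  This gives the recovery formula, and it forces \<open>z\<close> itself to be unique.
\<close>

section \<open>The box and the \<open>\<ell>\<^sub>1\<close> norm\<close>

lemma mem_box_iff:
  fixes z :: "real ^ 'n"
  shows "- vec 1 \<le> z \<and> z \<le> vec 1 \<longleftrightarrow> (\<forall>i. \<bar>z $ i\<bar> \<le> 1)"
  by (auto simp: less_eq_vec_def abs_le_iff minus_le_iff)

lemma box_qp_solution_in_box:
  assumes "is_box_qp_solution H h z"
  shows "\<bar>z $ i\<bar> \<le> 1"
  using assms mem_box_iff[of z] unfolding is_box_qp_solution_def is_arg_min_def by blast

lemma inner_box_le_l1_norm:
  fixes x z :: "real ^ 'n"
  assumes "\<forall>i. \<bar>z $ i\<bar> \<le> 1"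
  shows "x \<bullet> z \<le> l1_norm x"
  unfolding inner_vec_def l1_norm_def
proof (rule sum_mono)
  fix i
  have "x $ i * z $ i \<le> \<bar>x $ i\<bar> * \<bar>z $ i\<bar>"
    by (metis abs_ge_self abs_mult)
  also have "\<dots> \<le> \<bar>x $ i\<bar>"
    using assms by (simp add: mult_left_le)
  finally show "x $ i \<bullet> z $ i \<le> \<bar>x $ i\<bar>"
    by simp
qed

lemma inner_sgn_eq_l1_norm:
  fixes x :: "real ^ 'n"
  shows "x \<bullet> (\<chi> i. sgn (x $ i)) = l1_norm x"
  by (simp add: inner_vec_def l1_norm_def abs_sgn)

section \<open>First-order optimality for the quadratic program\<close>

lemma qp_objective_along_direction:
  fixes H :: "real ^ 'n ^ 'n"
  assumes "transpose H = H"
  shows "qp_objective H h (z + t *\<^sub>R d) =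
    qp_objective H h z + t * (d \<bullet> (H *v z + h)) + t\<^sup>2 / 2 * (d \<bullet> (H *v d))"
proof -
  have "z \<bullet> (H *v d) = d \<bullet> (H *v z)"
    by (metis assms dot_lmul_matrix inner_commute transpose_matrix_vector)
  then show ?thesis
    unfolding qp_objective_def
    by (simp add: matrix_vector_right_distrib matrix_vector_mult_scaleR inner_add_left
        inner_add_right algebra_simps power2_eq_square)
qed

text \<open>
  A quadratic \<open>t \<mapsto> \<alpha> t + \<beta> t\<^sup>2\<close> with \<open>\<alpha> < 0\<close> is negative just to the right of \<open>0\<close>, so the slope towards
  any other point of the convex feasible set cannot be negative.
\<close>

lemma quadratic_minimizer_variational_inequality:
  fixes H :: "real ^ 'n ^ 'n"
  assumes sym: "transpose H = H" and "convex S"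
    and min: "is_arg_min (qp_objective H h) (\<lambda>z. z \<in> S) z" and "w \<in> S"
  shows "0 \<le> (w - z) \<bullet> (H *v z + h)"
proof -
  define d where "d = w - z"
  have zS: "z \<in> S" and least: "qp_objective H h z \<le> qp_objective H h y" if "y \<in> S" for y
    using min that by (auto simp: is_arg_min_linorder)
  have "0 \<le> d \<bullet> (H *v z + h) + t / 2 * (d \<bullet> (H *v d))" if "0 < t" "t < 1" for t :: real
  proof -
    have "z + t *\<^sub>R d = (1 - t) *\<^sub>R z + t *\<^sub>R w"
      by (simp add: d_def algebra_simps)
    also have "\<dots> \<in> S"
      using \<open>convex S\<close> zS \<open>w \<in> S\<close> that by (auto simp: convex_alt)
    finally have "0 \<le> t * (d \<bullet> (H *v z + h)) + t\<^sup>2 / 2 * (d \<bullet> (H *v d))"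
      using least qp_objective_along_direction[OF sym, of h z t d] by fastforce
    also have "\<dots> = t * (d \<bullet> (H *v z + h) + t / 2 * (d \<bullet> (H *v d)))"
      by (simp add: algebra_simps power2_eq_square)
    finally show ?thesis
      using \<open>0 < t\<close> by (simp add: zero_le_mult_iff)
  qed
  then have "eventually (\<lambda>t. 0 \<le> d \<bullet> (H *v z + h) + t / 2 * (d \<bullet> (H *v d))) (at_right 0)"
    by (auto simp: eventually_at_right[of 0 1] intro!: exI[of _ 1])
  moreover have "((\<lambda>t. d \<bullet> (H *v z + h) + t / 2 * (d \<bullet> (H *v d)))
      \<longlongrightarrow> d \<bullet> (H *v z + h) + 0 / 2 * (d \<bullet> (H *v d))) (at_right 0)"
    by (intro tendsto_intros) simp_all
  ultimately have "0 \<le> d \<bullet> (H *v z + h) + 0 / 2 * (d \<bullet> (H *v d))"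
    by (intro tendsto_lowerbound) auto
  then show ?thesis
    by (simp add: d_def)
qed

lemma box_qp_solution_exists:
  fixes H :: "real ^ 'n ^ 'n"
  shows "\<exists>z. is_box_qp_solution H h z"
proof -
  let ?B = "{- vec 1 .. vec 1 :: real ^ 'n}"
  have "0 \<in> ?B"
    by (simp add: less_eq_vec_def)
  moreover have "compact ?B"
    by (simp add: interval_cbox)
  moreover have "continuous_on ?B (qp_objective H h)"
    unfolding qp_objective_def
    by (intro continuous_intros matrix_vector_mult_linear_continuous_on)
  ultimately obtain z where "z \<in> ?B" "\<forall>y\<in>?B. qp_objective H h z \<le> qp_objective H h y"
    using continuous_attains_inf by blast
  then show ?thesis
    by (auto simp: is_box_qp_solution_def is_arg_min_linorder)
qed

text \<open>
  The point \<open>x\<close> stands for the negative gradient of the quadratic objective at \<open>z\<close>.  Testing the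
  variational inequality with the sign vector of \<open>x\<close> shows that \<open>z\<close> attains the \<open>\<ell>\<^sub>1\<close> norm of \<open>x\<close>.
\<close>

lemma box_qp_solution_attains_l1_norm:
  fixes H :: "real ^ 'n ^ 'n"
  assumes "transpose H = H" and sol: "is_box_qp_solution H h z"
    and x: "H *v z + h = - x"
  shows "x \<bullet> z = l1_norm x"
proof (rule antisym)
  let ?B = "{- vec 1 .. vec 1 :: real ^ 'n}" and ?s = "\<chi> i. sgn (x $ i)"
  have min: "is_arg_min (qp_objective H h) (\<lambda>z. z \<in> ?B) z"
    using sol by (simp add: is_box_qp_solution_def)
  have "?s \<in> ?B"
    unfolding atLeastAtMost_iff mem_box_iff by (simp add: abs_sgn_eq)
  moreover have "convex ?B"
    by (simp add: interval_cbox)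
  ultimately have "0 \<le> (?s - z) \<bullet> (H *v z + h)"
    using assms(1) min quadratic_minimizer_variational_inequality by blast
  then have "x \<bullet> ?s \<le> x \<bullet> z"
    by (simp add: x inner_diff_left) (simp add: inner_commute)
  then show "l1_norm x \<le> x \<bullet> z"
    by (simp add: inner_sgn_eq_l1_norm)
  show "x \<bullet> z \<le> l1_norm x"
    using box_qp_solution_in_box[OF sol] by (simp add: inner_box_le_l1_norm)
qed

section \<open>The optimality certificate for the Lasso\<close>

text \<open>
  The equation for \<open>x\<close> makes the linear term of the expanded square equal to
  \<open>- \<lambda> (y - x) \<bullet> z\<close>, while \<open>z\<close> being a subgradient of the \<open>\<ell>\<^sub>1\<close> norm at \<open>x\<close> bounds the change of
  the penalty below by \<open>\<lambda> (y - x) \<bullet> z\<close>.  The two cancel and only the square term is left.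
\<close>

lemma lasso_growth_from_certificate:
  fixes A :: "real ^ 'n ^ 'm" and x y z :: "real ^ 'n"
  assumes "lam > 0" and box: "\<forall>i. \<bar>z $ i\<bar> \<le> 1" and attains: "x \<bullet> z = l1_norm x"
    and eq: "transpose A *v (A *v x - b) = - (lam *\<^sub>R z)"
  shows "lasso_objective A b lam x + (norm (A *v (y - x)))\<^sup>2 / 2 \<le> lasso_objective A b lam y"
proof -
  have split: "A *v y - b = (A *v x - b) + A *v (y - x)"
    by (simp add: matrix_vector_mult_diff_distrib)
  have "(A *v x - b) \<bullet> (A *v (y - x)) = (transpose A *v (A *v x - b)) \<bullet> (y - x)"
    by (simp add: dot_lmul_matrix)
  also have "\<dots> = lam * (x \<bullet> z - y \<bullet> z)"
    unfolding eq by (simp add: inner_diff_right inner_commute algebra_simps)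
  finally have "(norm (A *v y - b))\<^sup>2 =
      (norm (A *v x - b))\<^sup>2 + 2 * (lam * (x \<bullet> z - y \<bullet> z)) + (norm (A *v (y - x)))\<^sup>2"
    unfolding split by (simp add: power2_norm_eq_inner inner_add_left inner_add_right inner_commute)
  moreover have "lam * (y \<bullet> z) \<le> lam * l1_norm y"
    using \<open>lam > 0\<close> inner_box_le_l1_norm[OF box] by simp
  ultimately show ?thesis
    unfolding lasso_objective_def attains by (simp add: algebra_simps)
qed

section \<open>The Gram matrix\<close>

lemma full_rank_square_invertible:
  fixes G :: "real ^ 'n ^ 'n"
  assumes "rank G = CARD('n)"
  shows "invertible G"
  by (metis assms full_rank_injective invertible_left_inverse matrix_left_invertible_injective)

lemma matrix_mult_matrix_inv:
  fixes G :: "real ^ 'n ^ 'n"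
  assumes "invertible G"
  shows "G ** matrix_inv G = mat 1" and "matrix_inv G ** G = mat 1"
  using assms someI_ex[of "\<lambda>B. G ** B = mat 1 \<and> B ** G = mat 1"]
  unfolding invertible_def matrix_inv_def by auto

lemma matrix_vector_mult_matrix_inv:
  fixes G :: "real ^ 'n ^ 'n"
  assumes "invertible G"
  shows "G *v (matrix_inv G *v v) = v" and "matrix_inv G *v (G *v v) = v"
  by (simp_all add: assms matrix_mult_matrix_inv matrix_vector_mul_assoc)

lemma transpose_matrix_inv_of_symmetric:
  fixes G :: "real ^ 'n ^ 'n"
  assumes "invertible G" and "transpose G = G"
  shows "transpose (matrix_inv G) = matrix_inv G"
proof -
  have "transpose (matrix_inv G) ** G = transpose (G ** matrix_inv G)"
    by (simp add: matrix_transpose_mul assms(2))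
  also have "\<dots> = mat 1"
    by (simp add: matrix_mult_matrix_inv(1)[OF assms(1)] transpose_mat)
  finally have "transpose (matrix_inv G) ** (G ** matrix_inv G) = matrix_inv G"
    by (simp add: matrix_mul_assoc)
  then show ?thesis
    by (simp add: matrix_mult_matrix_inv(1)[OF assms(1)])
qed

section \<open>Recovery of the Lasso solution\<close>

theorem lemma2:
  fixes A :: "real ^ 'n ^ 'm" and b :: "real ^ 'm" and lam :: real
    and H :: "real ^ 'n ^ 'n" and h :: "real ^ 'n"
  assumes "CARD('n) \<le> CARD('m)"
    and "rank (transpose A ** A) = CARD('n)"
    and "lam > 0"
    and "H = lam *\<^sub>R matrix_inv (transpose A ** A)"
    and "h = - (matrix_inv (transpose A ** A) *v (transpose A *v b))"
  shows "(\<exists>!x. is_lasso_solution A b lam x) \<and>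
    (\<exists>!z. is_box_qp_solution H h z) \<and>
    (\<forall>x z. is_lasso_solution A b lam x \<longrightarrow> is_box_qp_solution H h z \<longrightarrow>
       x = matrix_inv (transpose A ** A) *v (transpose A *v b - lam *\<^sub>R z))"
proof -
  define G where "G = transpose A ** A"
  define c where "c = transpose A *v b"
  define P where "P z = matrix_inv G *v (c - lam *\<^sub>R z)" for z
  note G_inv = full_rank_square_invertible[OF assms(2), folded G_def]
  have G_apply: "G *v v = transpose A *v (A *v v)" for v
    by (simp only: G_def matrix_vector_mul_assoc)
  have A_inj: "v = 0" if "A *v v = 0" for v
    using matrix_vector_mult_matrix_inv(2)[OF G_inv, of v] that by (simp add: G_apply)
  have "transpose G = G"
    by (simp add: G_def matrix_transpose_mul)
  then have H_sym: "transpose H = H"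
    using transpose_matrix_inv_of_symmetric[OF G_inv] assms(4)
    by (simp add: G_def transpose_scalar)
  \<comment> \<open>A box minimizer \<open>z\<close> certifies optimality of its image \<open>P z\<close>, which is the negative gradient
    of the quadratic objective at \<open>z\<close>.\<close>
  have P_growth: "lasso_objective A b lam (P z) + (norm (A *v (y - P z)))\<^sup>2 / 2
      \<le> lasso_objective A b lam y" if "is_box_qp_solution H h z" for y z
  proof (rule lasso_growth_from_certificate)
    show "lam > 0" by fact
    show "\<forall>i. \<bar>z $ i\<bar> \<le> 1"
      using box_qp_solution_in_box[OF that] by simp
    have "H *v z + h = - P z"
      by (simp add: P_def assms(4,5) G_def c_def matrix_vector_mult_diff_distrib
          matrix_vector_mult_scaleR scaleR_matrix_vector_assoc[symmetric])
    then show "P z \<bullet> z = l1_norm (P z)"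
      by (rule box_qp_solution_attains_l1_norm[OF H_sym that])
    have "G *v P z = c - lam *\<^sub>R z"
      by (simp add: P_def matrix_vector_mult_matrix_inv(1)[OF G_inv])
    then show "transpose A *v (A *v P z - b) = - (lam *\<^sub>R z)"
      by (simp only: matrix_vector_mult_diff_distrib G_apply c_def) simp
  qed
  have P_lasso: "is_lasso_solution A b lam x \<longleftrightarrow> x = P z" if "is_box_qp_solution H h z" for x z
  proof
    assume "is_lasso_solution A b lam x"
    then have "lasso_objective A b lam x \<le> lasso_objective A b lam (P z)"
      by (simp add: is_lasso_solution_def is_arg_min_linorder)
    then have "(norm (A *v (x - P z)))\<^sup>2 \<le> 0"
      using P_growth[OF that, of x] by linarith
    then show "x = P z"
      using A_inj[of "x - P z"] by simp
  next
    assume "x = P z"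
    moreover have "lasso_objective A b lam (P z) \<le> lasso_objective A b lam y" for y
      using P_growth[OF that, of y] zero_le_power2[of "norm (A *v (y - P z))"] by linarith
    ultimately show "is_lasso_solution A b lam x"
      by (simp add: is_lasso_solution_def is_arg_min_linorder)
  qed
  have P_inj: "z = z'" if "P z = P z'" for z z'
  proof -
    have "G *v P z = G *v P z'"
      by (simp only: that)
    then have "c - lam *\<^sub>R z = c - lam *\<^sub>R z'"
      by (simp only: P_def matrix_vector_mult_matrix_inv(1)[OF G_inv])
    then show ?thesis
      using \<open>lam > 0\<close> by simp
  qed
  obtain z where z: "is_box_qp_solution H h z"
    using box_qp_solution_exists by blast
  have "\<exists>!x. is_lasso_solution A b lam x"
    using P_lasso[OF z] by simp
  moreover have "\<exists>!z. is_box_qp_solution H h z"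
    using z P_lasso P_inj by metis
  moreover have "\<forall>x z. is_lasso_solution A b lam x \<longrightarrow> is_box_qp_solution H h z \<longrightarrow> x = P z"
    using P_lasso by blast
  ultimately show ?thesis
    by (simp only: P_def G_def c_def)
qed

end
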